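(* Let $E$ be a normed space and let $X$ be a metric space over $E$. Then there exists a Banach space $\mathrm{AE}(X,E)$ together with an isometric embedding $X\subseteq\mathrm{AE}(X,E)$ which is linear on $E$, with the following universal property: for every Banach space $F$, every $\theta\in\mathrm{Lip}_E(X,F)$ admits a unique continuous linear extension $\theta'\colon\mathrm{AE}(X,E)\to F$, and this extension satisfies $\|\theta'\|\le L(\theta)$. This universal property characterises $\mathrm{AE}(X,E)$ up to a unique isometric isomorphism, and the dual space $\mathrm{AE}(X,E)^*$ is isometrically isomorphic to $\mathrm{Lip}_E(X)$ via restriction of functionals to $X$.
   Context: Normed spaces are over $\mathbf{R}$. A metric space over a normed space $E$ is a metric space $X$ together with an isometric map $E\to X$ (regarded as an inclusion $E\subseteq X$) such that for every $x\in X$ the function $a\mapsto d(a,x)$ on $E$ is convex. For a normed space $F$, $\mathrm{Lip}_E(X,F)$ denotes the set of Lipschitz maps $\theta\colon X\to F$ whose restriction to $E$ is linear, and $\mathrm{Lip}_E(X)=\mathrm{Lip}_E(X,\mathbf{R})$, normed by the Lipschitz constant. For a Lipschitz map $\theta$, $L(\theta)$ denotes its Lipschitz constant. *)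

theory Defs
  imports "HOL-Analysis.Analysis" "HOL-Probability.Discrete_Topology"
begin

text \<open>
  A normed space is a linear subspace of a type of class \<open>real_normed_vector\<close>, and a Banach
  space is a complete such subspace. (The full carrier of a type of class \<open>banach\<close> is a special
  case, and every Banach space is of this form.) A proper subspace is needed because
  \<open>AE(X, E)\<close> depends on the inclusion of \<open>E\<close> in \<open>X\<close>, which is a term, so that
  \<open>AE(X, E)\<close> cannot be a type of its own.
\<close>

definition banach_space_on :: "'a::real_normed_vector set \<Rightarrow> bool" where
  "banach_space_on V \<longleftrightarrow> subspace V \<and> complete V"

definition linear_on_subspace ::
    "'a::real_vector set \<Rightarrow> ('a \<Rightarrow> 'b::real_vector) \<Rightarrow> bool" where
  "linear_on_subspace V T \<longleftrightarrow>
     (\<forall>u\<in>V. \<forall>v\<in>V. \<forall>a b. T (a *\<^sub>R u + b *\<^sub>R v) = a *\<^sub>R T u + b *\<^sub>R T v)"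

text \<open>
  Maps defined on a subspace \<open>V\<close> are extensional, so that they are equal in HOL as soon as they
  agree on \<open>V\<close>.
\<close>

definition cont_linear_maps ::
    "'a::real_normed_vector set \<Rightarrow> 'b::real_normed_vector set \<Rightarrow> ('a \<Rightarrow> 'b) set" where
  "cont_linear_maps V W = {T \<in> V \<rightarrow>\<^sub>E W. linear_on_subspace V T \<and> continuous_on V T}"

text \<open>The relative version of \<^const>\<open>onorm\<close> (with \<open>0 / 0 = 0\<close>).\<close>

definition onorm_on ::
    "'a::real_normed_vector set \<Rightarrow> ('a \<Rightarrow> 'b::real_normed_vector) \<Rightarrow> real" where
  "onorm_on V T = (SUP v\<in>V. norm (T v) / norm v)"

definition isometric_isomorphism ::
    "'a::real_normed_vector set \<Rightarrow> 'b::real_normed_vector set \<Rightarrow> ('a \<Rightarrow> 'b) \<Rightarrow> bool" where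
  "isometric_isomorphism V W \<Phi> \<longleftrightarrow>
     \<Phi> \<in> extensional V \<and> linear_on_subspace V \<Phi> \<and> \<Phi> ` V = W \<and> (\<forall>v\<in>V. norm (\<Phi> v) = norm v)"

definition isometric_map :: "('a::metric_space \<Rightarrow> 'b::metric_space) \<Rightarrow> bool" where
  "isometric_map f \<longleftrightarrow> (\<forall>x y. dist (f x) (f y) = dist x y)"

text \<open>The least Lipschitz constant.\<close>

definition lip_const :: "('a::metric_space \<Rightarrow> 'b::metric_space) \<Rightarrow> real" where
  "lip_const \<theta> = Inf {C. C-lipschitz_on UNIV \<theta>}"

text \<open>Here \<open>\<iota>\<close> is the inclusion of \<open>E\<close> in \<open>X\<close>.\<close>

definition metric_space_over ::
    "('e::real_normed_vector \<Rightarrow> 'x::metric_space) \<Rightarrow> bool" where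
  "metric_space_over \<iota> \<longleftrightarrow>
     isometric_map \<iota> \<and> (\<forall>x. convex_on UNIV (\<lambda>a. dist (\<iota> a) x))"

definition Lip_over ::
    "('e::real_normed_vector \<Rightarrow> 'x::metric_space) \<Rightarrow> 'f::real_normed_vector set \<Rightarrow> ('x \<Rightarrow> 'f) set"
  where
  "Lip_over \<iota> W =
     {\<theta>. range \<theta> \<subseteq> W \<and> (\<exists>C. C-lipschitz_on UNIV \<theta>) \<and> linear (\<theta> \<circ> \<iota>)}"

definition banach_extension ::
    "('e::real_normed_vector \<Rightarrow> 'x::metric_space) \<Rightarrow> 'b::real_normed_vector set \<Rightarrow>
      ('x \<Rightarrow> 'b) \<Rightarrow> bool" where
  "banach_extension \<iota> B j \<longleftrightarrow>
     banach_space_on B \<and> range j \<subseteq> B \<and> isometric_map j \<and> linear (j \<circ> \<iota>)"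

text \<open>
  The universal property of \<open>X \<subseteq> B\<close> (via \<open>j\<close>). HOL has no quantification over types inside a
  formula, so the type in which the target spaces \<open>W\<close> live is a parameter. A theorem that
  concludes the property for a type variable gives it for all Banach spaces.
\<close>

definition AE_universal ::
    "'f::real_normed_vector itself \<Rightarrow> ('e::real_normed_vector \<Rightarrow> 'x::metric_space) \<Rightarrow>
      'b::real_normed_vector set \<Rightarrow> ('x \<Rightarrow> 'b) \<Rightarrow> bool" where
  "AE_universal TF \<iota> B j \<longleftrightarrow>
     (\<forall>W :: 'f set. banach_space_on W \<longrightarrow>
       (\<forall>\<theta> \<in> Lip_over \<iota> W.
         (\<exists>!\<theta>'. \<theta>' \<in> cont_linear_maps B W \<and> (\<forall>x. \<theta>' (j x) = \<theta> x)) \<and>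
         (\<forall>\<theta>'. \<theta>' \<in> cont_linear_maps B W \<and> (\<forall>x. \<theta>' (j x) = \<theta> x) \<longrightarrow>
            onorm_on B \<theta>' \<le> lip_const \<theta>)))"

text \<open>
  The witness: \<open>X\<close> is mapped to evaluation functionals on the unit ball of
  \<open>Lip\<^sub>E(X)\<close>, regarded as elements of the Banach space of bounded functions on
  \<open>'x \<Rightarrow> real\<close> (discrete topology) that vanish off that ball, and \<open>AE(X, E)\<close> is the closed
  linear span of the image. It is a constant and not an existentially bound variable because a
  bound variable could depend on the type of the target spaces in the universal property.
\<close>

type_synonym 'x ae_type = "('x \<Rightarrow> real) discrete \<Rightarrow>\<^sub>C real"

definition Lip_ball ::
    "('e::real_normed_vector \<Rightarrow> 'x::metric_space) \<Rightarrow> ('x \<Rightarrow> real) set" where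
  "Lip_ball \<iota> = {f \<in> Lip_over \<iota> UNIV. 1-lipschitz_on UNIV f}"

definition AE_emb ::
    "('e::real_normed_vector \<Rightarrow> 'x::metric_space) \<Rightarrow> 'x \<Rightarrow> 'x ae_type" where
  "AE_emb \<iota> x =
     Bcontfun (\<lambda>f. if of_discrete f \<in> Lip_ball \<iota> then of_discrete f x else 0)"

definition AE_space ::
    "('e::real_normed_vector \<Rightarrow> 'x::metric_space) \<Rightarrow> 'x ae_type set" where
  "AE_space \<iota> = closure (span (range (AE_emb \<iota>)))"

lemma apply_AE_emb:
  "apply_bcontfun (AE_emb \<iota> x) f = (if of_discrete f \<in> Lip_ball \<iota> then of_discrete f x else 0)"
proof -
  let ?g = "\<lambda>f. if of_discrete f \<in> Lip_ball \<iota> then of_discrete f x else 0"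
  have "\<bar>f x\<bar> \<le> dist x (\<iota> 0)" if "f \<in> Lip_ball \<iota>" for f
  proof -
    have "linear (f \<circ> \<iota>)" and L: "1-lipschitz_on UNIV f"
      using that by (auto simp: Lip_ball_def Lip_over_def)
    then have "f (\<iota> 0) = 0" using linear_0[of "f \<circ> \<iota>"] by simp
    with lipschitz_onD[OF L, of x "\<iota> 0"] show ?thesis by (simp add: dist_real_def)
  qed
  then have "bounded (range ?g)"
    by (intro boundedI[where B = "dist x (\<iota> 0)"]) auto
  moreover have "continuous_on UNIV ?g"
    by (auto simp: continuous_on_open_vimage open_discrete)
  ultimately have "?g \<in> bcontfun" by (simp add: bcontfun_def)
  then show ?thesis by (simp add: AE_emb_def Bcontfun_inverse)
qed

end

theory Submission
  imports Defs
begin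

text \<open>
  The embedding by evaluation functionals is isometric because any two points \<open>x\<close>, \<open>y\<close> are
  separated by a 1-Lipschitz \<open>f\<close> with \<open>f y - f x = d(x, y)\<close> that is linear on \<open>E\<close>. The only
  nontrivial point is the choice of \<open>f\<close> on \<open>E\<close>: one needs an affine function between the concave
  \<open>- d(\<cdot>, x)\<close> and the convex \<open>d(\<cdot>, y) - d(x, y)\<close>, which Hahn--Banach provides; the rest of \<open>X\<close> is
  then handled by McShane's formula. Applying a norming functional of \<open>F\<close> to \<open>\<theta>\<close> gives a multiple
  of a member of the unit ball of \<open>Lip\<^sub>E(X)\<close>, hence
  \<open>\<parallel>\<Sum> c\<^sub>i \<theta>(x\<^sub>i)\<parallel> \<le> L(\<theta>) \<parallel>\<Sum> c\<^sub>i x\<^sub>i\<parallel>\<close> in \<open>AE(X, E)\<close>, so that the closure of the span of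
  the pairs \<open>(x, \<theta> x)\<close> is the graph of the extension of \<open>\<theta>\<close>.
\<close>

section \<open>Convex functions and the Hahn--Banach theorem\<close>

lemma convex_on_combination:
  assumes "convex_on UNIV p" "0 \<le> u" "0 \<le> v" "u + v = 1"
  shows "p (u *\<^sub>R x + v *\<^sub>R y) \<le> u * p x + v * p y"
  using assms by (simp add: convex_on_def)

text \<open>Near-optimal indices \<open>i\<close> at \<open>x\<close> and \<open>j\<close> at
  \<open>y\<close> merge into one index \<open>k\<close>, which bounds the infimum at the
  intermediate point up to an arbitrary \<open>e\<close>. This serves infima over chains as well as
  the minimisation of a jointly convex function over one argument.\<close>

lemma convex_on_INF_directed:
  fixes f :: "'i \<Rightarrow> 'a::real_vector \<Rightarrow> real"
  assumes "I \<noteq> {}" and bdd: "\<And>x. bdd_below ((\<lambda>i. f i x) ` I)"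
    and dir: "\<And>i j x y u v. i \<in> I \<Longrightarrow> j \<in> I \<Longrightarrow> 0 \<le> u \<Longrightarrow> 0 \<le> v \<Longrightarrow> u + v = 1 \<Longrightarrow>
      \<exists>k\<in>I. f k (u *\<^sub>R x + v *\<^sub>R y) \<le> u * f i x + v * f j y"
  shows "convex_on UNIV (\<lambda>x. INF i\<in>I. f i x)"
  unfolding convex_on_def
proof (intro conjI ballI allI impI)
  fix x y :: 'a and u v :: real
  assume uv: "0 \<le> u" "0 \<le> v" "u + v = 1"
  let ?F = "\<lambda>x. INF i\<in>I. f i x"
  show "?F (u *\<^sub>R x + v *\<^sub>R y) \<le> u * ?F x + v * ?F y"
  proof (rule field_le_epsilon)
    fix e :: real assume "0 < e"
    then obtain i j where i: "i \<in> I" "f i x < ?F x + e" and j: "j \<in> I" "f j y < ?F y + e"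
      using cInf_lessD[of "(\<lambda>i. f i x) ` I" "?F x + e"] cInf_lessD[of "(\<lambda>i. f i y) ` I" "?F y + e"]
        \<open>I \<noteq> {}\<close> by auto
    obtain k where k: "k \<in> I" "f k (u *\<^sub>R x + v *\<^sub>R y) \<le> u * f i x + v * f j y"
      using dir[OF i(1) j(1) uv] by blast
    have "?F (u *\<^sub>R x + v *\<^sub>R y) \<le> f k (u *\<^sub>R x + v *\<^sub>R y)"
      by (rule cINF_lower[OF bdd k(1)])
    also have "\<dots> \<le> u * f i x + v * f j y" by (rule k)
    also have "\<dots> \<le> u * (?F x + e) + v * (?F y + e)"
      using i j uv by (intro add_mono mult_left_mono) auto
    also have "\<dots> = u * ?F x + v * ?F y + (u + v) * e"
      by (simp add: algebra_simps)
    finally show "?F (u *\<^sub>R x + v *\<^sub>R y) \<le> u * ?F x + v * ?F y + e"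
      using uv by simp
  qed
qed simp

lemma convex_on_INF_chain:
  fixes C :: "('a::real_vector \<Rightarrow> real) set"
  assumes "C \<noteq> {}" and "\<And>x. bdd_below ((\<lambda>p. p x) ` C)"
    and conv: "\<And>p. p \<in> C \<Longrightarrow> convex_on UNIV p"
    and chain: "\<And>p q. p \<in> C \<Longrightarrow> q \<in> C \<Longrightarrow> p \<le> q \<or> q \<le> p"
  shows "convex_on UNIV (\<lambda>x. INF p\<in>C. p x)"
proof (rule convex_on_INF_directed)
  fix p q x y and u v :: real
  assume pq: "p \<in> C" "q \<in> C" and uv: "0 \<le> u" "0 \<le> v" "u + v = 1"
  obtain r where r: "r \<in> C" "r \<le> p" "r \<le> q"
    using chain[OF pq] pq by auto
  have "r (u *\<^sub>R x + v *\<^sub>R y) \<le> u * r x + v * r y"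
    by (rule convex_on_combination[OF conv[OF r(1)] uv])
  also have "\<dots> \<le> u * p x + v * q y"
    using r uv by (intro add_mono mult_left_mono) (auto simp: le_fun_def)
  finally show "\<exists>k\<in>C. k (u *\<^sub>R x + v *\<^sub>R y) \<le> u * p x + v * q y"
    using r(1) by blast
qed (use assms in auto)

text \<open>As 0 lies between \<open>- r a\<close> and \<open>t a\<close>, convexity and
  \<open>0 \<le> p 0\<close> give \<open>- p (- r a) / r \<le> p (t a) / t\<close>: every slope to
  the left is below every slope to the right. Any number in between serves as \<open>s\<close>; the
  infimum of the right slopes is taken.\<close>

lemma subgradient_along_line:
  fixes p :: "'a::real_vector \<Rightarrow> real"
  assumes p: "convex_on UNIV p" and p0: "0 \<le> p 0"
  obtains s where "\<And>t. s * t \<le> p (t *\<^sub>R a)"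
proof
  let ?S = "(\<lambda>t. p (t *\<^sub>R a) / t) ` {0<..}"
  have neg: "0 \<le> p ((- r) *\<^sub>R a) / r + p (t *\<^sub>R a) / t" if "0 < r" "0 < t" for r t :: real
  proof -
    \<comment> \<open>These weights put the convex combination of the two points at 0.\<close>
    have "p ((t / (r + t)) *\<^sub>R ((- r) *\<^sub>R a) + (r / (r + t)) *\<^sub>R (t *\<^sub>R a))
        \<le> t / (r + t) * p ((- r) *\<^sub>R a) + r / (r + t) * p (t *\<^sub>R a)"
      using that by (intro convex_on_combination[OF p]) (auto simp: add_divide_distrib[symmetric] add.commute)
    moreover have "(t / (r + t)) *\<^sub>R ((- r) *\<^sub>R a) + (r / (r + t)) *\<^sub>R (t *\<^sub>R a) = 0"
      by (simp add: mult.commute)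
    ultimately have "0 \<le> t / (r + t) * p ((- r) *\<^sub>R a) + r / (r + t) * p (t *\<^sub>R a)"
      using p0 by (simp add: mult.commute[of t r])
    also have "\<dots> = (r * t / (r + t)) * (p ((- r) *\<^sub>R a) / r + p (t *\<^sub>R a) / t)"
      using that by (simp add: distrib_left)
    finally have "(r * t / (r + t)) * 0 \<le> (r * t / (r + t)) * (p ((- r) *\<^sub>R a) / r + p (t *\<^sub>R a) / t)"
      by (simp only: mult_zero_right)
    moreover have "0 < r * t / (r + t)" using that by simp
    ultimately show ?thesis by (rule mult_left_le_imp_le)
  qed
  have bdd: "bdd_below ?S"
  proof (rule bdd_belowI)
    fix y assume "y \<in> ?S"
    then show "- p (- a) \<le> y"
      using neg[of 1] by force
  qed
  show "Inf ?S * t \<le> p (t *\<^sub>R a)" for t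
  proof (cases t "0::real" rule: linorder_cases)
    case greater
    then have "Inf ?S \<le> p (t *\<^sub>R a) / t"
      using bdd by (intro cINF_lower) auto
    with greater show ?thesis by (simp add: field_simps)
  next
    case less
    have "p (t *\<^sub>R a) / t \<le> Inf ?S"
    proof (rule cINF_greatest)
      show "p (t *\<^sub>R a) / t \<le> p (x *\<^sub>R a) / x" if "x \<in> {0<..}" for x
        using neg[of "- t" x] less that by simp
    qed simp
    with less show ?thesis by (simp add: field_simps)
  qed (use p0 in simp)
qed

text \<open>The Hahn--Banach theorem for convex functions: a minimal convex function among those that
  are nonnegative at \<open>0\<close> and lie below \<open>h\<close> is affine, because subtracting a subgradient along a
  line and minimising over that line cannot make it smaller.\<close>

lemma convex_above_linear:
  fixes h :: "'a::real_vector \<Rightarrow> real"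
  assumes h: "convex_on UNIV h" "0 \<le> h 0"
  obtains g where "linear g" "\<And>v. g v \<le> h v"
proof -
  define A where "A = {p :: 'a \<Rightarrow> real. convex_on UNIV p \<and> 0 \<le> p 0 \<and> p \<le> h}"
  \<comment> \<open>Zorn's lemma yields maximal elements; the reversed order makes them minimal
    functions.\<close>
  define P where "P = (\<lambda>p q :: 'a \<Rightarrow> real. q \<le> p)"
  \<comment> \<open>Convexity at the midpoint of \<open>x\<close> and \<open>- x\<close>. Together
    with \<open>p \<le> h\<close> it bounds every member of \<open>A\<close> below by
    \<open>- h (- x)\<close>, so that infima over chains are finite.\<close>
  have mid: "0 \<le> p x + p (- x)" if "p \<in> A" for p x
  proof -
    have "p ((1/2) *\<^sub>R x + (1/2) *\<^sub>R (- x)) \<le> 1/2 * p x + 1/2 * p (- x)"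
      using that by (intro convex_on_combination) (auto simp: A_def)
    then show ?thesis using that by (simp add: A_def)
  qed
  have "\<exists>m\<in>A. \<forall>q\<in>A. P m q \<longrightarrow> q = m"
  proof (rule predicate_Zorn)
    show "partial_order_on A (relation_of P A)"
      by (rule partial_order_on_relation_ofI) (auto simp: P_def)
    fix C assume "C \<in> Chains (relation_of P A)"
    then have C: "C \<subseteq> A" and chain: "\<And>p q. p \<in> C \<Longrightarrow> q \<in> C \<Longrightarrow> p \<le> q \<or> q \<le> p"
      by (auto simp: Chains_def relation_of_def P_def)
    show "\<exists>u\<in>A. \<forall>p\<in>C. P p u"
    proof (cases "C = {}")
      case True
      then show ?thesis using h by (auto simp: A_def)
    next
      case False
      have "- h (- x) \<le> p x" if "p \<in> C" for p x
        using mid[of p x] that C by (auto simp: A_def le_fun_def) (smt (verit) mem_Collect_eq subsetD)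
      then have bdd: "bdd_below ((\<lambda>p. p x) ` C)" for x
        by (intro bdd_belowI[of _ "- h (- x)"]) auto
      have "convex_on UNIV (\<lambda>x. INF p\<in>C. p x)"
        using C by (intro convex_on_INF_chain False bdd chain) (auto simp: A_def)
      moreover have "0 \<le> (INF p\<in>C. p 0)"
        using False C by (intro cINF_greatest) (auto simp: A_def)
      moreover have low: "(INF p\<in>C. p x) \<le> p x" if "p \<in> C" for p x
        using that by (intro cINF_lower bdd)
      moreover have "(INF p\<in>C. p x) \<le> h x" for x
      proof -
        obtain p where "p \<in> C" using False by blast
        then have "(INF p\<in>C. p x) \<le> p x" "p x \<le> h x"
          using low C by (auto simp: A_def le_fun_def)
        then show ?thesis by simp
      qed
      ultimately show ?thesis
        by (intro bexI[of _ "\<lambda>x. INF p\<in>C. p x"]) (auto simp: A_def P_def le_fun_def)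
    qed
  qed
  then obtain m where m: "m \<in> A" and min: "\<And>q. q \<in> A \<Longrightarrow> q \<le> m \<Longrightarrow> q = m"
    by (auto simp: P_def)
  have conv: "convex_on UNIV m" and m0: "0 \<le> m 0" and mh: "m \<le> h"
    using m by (auto simp: A_def)
  have "\<exists>s. \<forall>v t. m (v + t *\<^sub>R a) = m v + s * t" for a
  proof -
    obtain s where s: "\<And>t. s * t \<le> m (t *\<^sub>R a)"
      using subgradient_along_line[OF conv m0] by blast
    define q where "q = (\<lambda>v. INF t. m (v + t *\<^sub>R a) - s * t)"
    have "- m (- v) \<le> m (v + t *\<^sub>R a) - s * t" for v t
    proof -
      \<comment> \<open>The midpoint of \<open>v + t a\<close> and \<open>- v\<close> is
        \<open>(t / 2) a\<close>, where the subgradient bounds \<open>m\<close> below by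
        \<open>s * t / 2\<close>.\<close>
      have "m ((1/2) *\<^sub>R (v + t *\<^sub>R a) + (1/2) *\<^sub>R (- v)) \<le> 1/2 * m (v + t *\<^sub>R a) + 1/2 * m (- v)"
        by (rule convex_on_combination[OF conv]) auto
      moreover have "(1/2) *\<^sub>R (v + t *\<^sub>R a) + (1/2) *\<^sub>R (- v) = (t / 2) *\<^sub>R a"
        by (simp add: algebra_simps)
      ultimately show ?thesis using s[of "t / 2"] by simp
    qed
    then have bdd: "bdd_below (range (\<lambda>t. m (v + t *\<^sub>R a) - s * t))" for v
      by (intro bdd_belowI[of _ "- m (- v)"]) auto
    have q_le: "q v \<le> m (v + t *\<^sub>R a) - s * t" for v t
      unfolding q_def by (rule cINF_lower[OF bdd]) simp
    have "convex_on UNIV q"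
      unfolding q_def
    proof (rule convex_on_INF_directed[OF _ bdd])
      fix i j u w :: real and x y :: 'a
      assume uw: "0 \<le> u" "0 \<le> w" "u + w = 1"
      have "m (u *\<^sub>R (x + i *\<^sub>R a) + w *\<^sub>R (y + j *\<^sub>R a))
          \<le> u * m (x + i *\<^sub>R a) + w * m (y + j *\<^sub>R a)"
        by (rule convex_on_combination[OF conv uw])
      moreover have "u *\<^sub>R (x + i *\<^sub>R a) + w *\<^sub>R (y + j *\<^sub>R a)
          = u *\<^sub>R x + w *\<^sub>R y + (u * i + w * j) *\<^sub>R a"
        by (simp add: algebra_simps)
      ultimately show "\<exists>k\<in>UNIV. m (u *\<^sub>R x + w *\<^sub>R y + k *\<^sub>R a) - s * k
          \<le> u * (m (x + i *\<^sub>R a) - s * i) + w * (m (y + j *\<^sub>R a) - s * j)"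
        by (intro bexI[of _ "u * i + w * j"]) (auto simp: algebra_simps)
    qed simp
    moreover have "0 \<le> q 0"
      unfolding q_def using s by (intro cINF_greatest) auto
    moreover have "q \<le> m"
      using q_le[of _ 0] by (simp add: le_fun_def)
    ultimately have "q = m"
      using mh by (intro min) (auto simp: A_def)
    then have le: "m v \<le> m (v + t *\<^sub>R a) - s * t" for v t
      using q_le by simp
    \<comment> \<open>Moving by \<open>t\<close> and then back by \<open>- t\<close> turns the
      inequality \<open>le\<close> into an equality.\<close>
    have "m (v + t *\<^sub>R a) = m v + s * t" for v t
      using le[of v t] le[of "v + t *\<^sub>R a" "- t"] by simp
    then show ?thesis by blast
  qed
  \<comment> \<open>The slope in direction \<open>a\<close> is the same at every base point
    \<open>v\<close>; comparison with the base point 0 yields additivity.\<close>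
  then obtain s where s: "\<And>a v t. m (v + t *\<^sub>R a) = m v + s a * t"
    by metis
  show thesis
  proof
    have s': "s a = m a - m 0" for a
      using s[of 0 1 a] by simp
    show "linear (\<lambda>v. m v - m 0)"
    proof (rule linearI)
      show "m (b1 + b2) - m 0 = m b1 - m 0 + (m b2 - m 0)" for b1 b2
        using s[of b1 1 b2] s' by simp
      show "m (r *\<^sub>R b) - m 0 = r *\<^sub>R (m b - m 0)" for r b
        using s[of 0 r b] s' by (simp add: algebra_simps)
    qed
    show "m v - m 0 \<le> h v" for v
      using mh m0 by (auto simp: le_fun_def) (smt (verit))
  qed
qed

section \<open>Separation of points by functions in \<open>Lip_ball\<close>\<close>

text \<open>Convexity of the distances to \<open>x\<close> and \<open>y\<close> makes
  \<open>h\<close> convex, so a linear \<open>g\<close> below it exists and \<open>u = - g\<close>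
  can be the restriction of \<open>f\<close> to \<open>E\<close>. The value \<open>c\<close> at
  \<open>x\<close> is then chosen as low as \<open>u\<close> permits, and \<open>f\<close> is
  extended from \<open>E\<close> and \<open>x\<close> so that it rises by the full distance at
  \<open>y\<close>.\<close>

lemma Lip_ball_separates:
  fixes \<iota> :: "'e::real_normed_vector \<Rightarrow> 'x::metric_space"
  assumes over: "metric_space_over \<iota>"
  obtains f where "f \<in> Lip_ball \<iota>" "f y - f x = dist x y"
proof -
  have iso: "dist (\<iota> a) (\<iota> b) = norm (a - b)" for a b
    using over by (simp add: metric_space_over_def isometric_map_def dist_norm)
  have conv: "dist (\<iota> (u *\<^sub>R a + v *\<^sub>R b)) z \<le> u * dist (\<iota> a) z + v * dist (\<iota> b) z"
    if "0 \<le> u" "0 \<le> v" "u + v = 1" for a b z u v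
    using over that unfolding metric_space_over_def convex_on_def by auto
  define D where "D = dist x y"
  \<comment> \<open>\<open>g \<le> h\<close> for a linear \<open>g\<close> says that \<open>- d(b, x) - g b \<le> d(a, y) - D - g a\<close> for all
    \<open>a\<close>, \<open>b\<close>, so that an additive constant fits between the two sides.\<close>
  define H where "H = (\<lambda>a v. dist (\<iota> a) y + dist (\<iota> (a - v)) x - D)"
  define h where "h = (\<lambda>v. INF a. H a v)"
  have bdd: "bdd_below (range (\<lambda>a. H a v))" for v
    by (intro bdd_belowI[of _ "- D"]) (auto simp: H_def)
  have h_le: "h v \<le> H a v" for a v
    unfolding h_def by (rule cINF_lower[OF bdd]) simp
  have "convex_on UNIV h"
    unfolding h_def
  proof (rule convex_on_INF_directed[OF _ bdd])
    fix a b v w :: 'e and s t :: real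
    assume st: "0 \<le> s" "0 \<le> t" "s + t = 1"
    \<comment> \<open>\<open>H\<close> is jointly convex in \<open>a\<close> and \<open>v\<close>,
      because both of its distances are taken from points that are linear in
      \<open>(a, v)\<close>.\<close>
    have "s *\<^sub>R a + t *\<^sub>R b - (s *\<^sub>R v + t *\<^sub>R w) = s *\<^sub>R (a - v) + t *\<^sub>R (b - w)"
      by (simp add: algebra_simps)
    moreover have "D = s * D + t * D"
      using st by (simp flip: distrib_right)
    ultimately have "H (s *\<^sub>R a + t *\<^sub>R b) (s *\<^sub>R v + t *\<^sub>R w) \<le> s * H a v + t * H b w"
      using conv[OF st, of a b y] conv[OF st, of "a - v" "b - w" x]
      unfolding H_def by (simp add: right_diff_distrib distrib_left)
    then show "\<exists>k\<in>UNIV. H k (s *\<^sub>R v + t *\<^sub>R w) \<le> s * H a v + t * H b w" by blast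
  qed simp
  moreover have "0 \<le> h 0"
    unfolding h_def
    by (intro cINF_greatest) (auto simp: H_def D_def dist_triangle3 add.commute)
  ultimately obtain g where g: "linear g" "\<And>v. g v \<le> h v"
    using convex_above_linear by blast
  have g_le: "g v \<le> H a v" for a v
    using g(2) h_le order_trans by blast
  \<comment> \<open>For \<open>0 \<le> t\<close>, \<open>H 0 (t v)\<close> is at most
    \<open>t * norm v + K\<close> with \<open>K\<close> independent of \<open>t\<close>, so a linear
    \<open>g\<close> with \<open>g v > norm v\<close> would outgrow it. The \<open>t\<close> below
    makes the excess exactly \<open>K + 1\<close>.\<close>
  have g_norm: "g v \<le> norm v" for v
  proof (rule ccontr)
    assume "\<not> g v \<le> norm v"
    then have e: "0 < g v - norm v" by simp
    define K where "K = dist (\<iota> 0) y + dist (\<iota> 0) x"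
    have K: "0 \<le> K" by (simp add: K_def)
    define t where "t = (K + 1) / (g v - norm v)"
    have t: "0 \<le> t" using e K by (simp add: t_def)
    have "t * g v = g (t *\<^sub>R v)"
      using linear_cmul[OF g(1)] by simp
    also have "\<dots> \<le> H 0 (t *\<^sub>R v)" by (rule g_le)
    also have "\<dots> \<le> dist (\<iota> 0) y + (dist (\<iota> (- (t *\<^sub>R v))) (\<iota> 0) + dist (\<iota> 0) x)"
      using dist_triangle[of "\<iota> (- (t *\<^sub>R v))" x "\<iota> 0"] by (simp add: H_def D_def) (smt (verit) zero_le_dist)
    also have "\<dots> = K + t * norm v"
      using t by (simp add: K_def iso)
    finally have "t * (g v - norm v) \<le> K" by (simp add: algebra_simps)
    moreover have "t * (g v - norm v) = K + 1" using e by (simp add: t_def)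
    ultimately show False by simp
  qed
  define u where "u = (\<lambda>a. - g a)"
  have lin_u: "linear u"
    unfolding u_def by (intro linear_compose_neg g)
  have u: "u a - u b \<le> norm (a - b)" for a b
    using g_norm[of "b - a"] linear_diff[OF g(1)] by (simp add: u_def norm_minus_commute)
  \<comment> \<open>With \<open>v = a - b\<close> the point \<open>a - v\<close> in
    \<open>H a v\<close> is \<open>b\<close>, so the two points of \<open>E\<close> vary
    independently.\<close>
  have sep: "D \<le> (u a + dist (\<iota> a) y) + (dist (\<iota> b) x - u b)" for a b
    using g_le[of "a - b" a] linear_diff[OF g(1)] by (simp add: u_def H_def)
  \<comment> \<open>McShane's formula: the largest 1-Lipschitz extension of \<open>u\<close> from
    \<open>E\<close> to \<open>X\<close>.\<close>
  define M where "M = (\<lambda>z. INF a. u a + dist (\<iota> a) z)"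
  have u_tri: "u b - dist (\<iota> b) z \<le> u a + dist (\<iota> a) z" for a b z
    using u[of b a] iso[of b a] dist_triangle2[of "\<iota> b" "\<iota> a" z] by simp
  have bddM: "bdd_below (range (\<lambda>a. u a + dist (\<iota> a) z))" for z
    using u_tri[of 0 z] by (intro bdd_belowI[of _ "u 0 - dist (\<iota> 0) z"]) auto
  have M_le: "M z \<le> u a + dist (\<iota> a) z" for a z
    unfolding M_def by (rule cINF_lower[OF bddM]) simp
  have le_M: "c \<le> M z" if "\<And>a. c \<le> u a + dist (\<iota> a) z" for c z
    unfolding M_def using that by (intro cINF_greatest) auto
  \<comment> \<open>The least value at \<open>x\<close> compatible with \<open>u\<close>. Being
    least, it stays \<open>D\<close> below every \<open>u a + dist (\<iota> a) y\<close> by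
    \<open>sep\<close>, which leaves room for the rise at \<open>y\<close>.\<close>
  define c where "c = (SUP b. u b - dist (\<iota> b) x)"
  have bddc: "bdd_above (range (\<lambda>b. u b - dist (\<iota> b) x))"
    using u_tri[of _ x 0] by (intro bdd_aboveI[of _ "u 0 + dist (\<iota> 0) x"]) auto
  have c_ge: "u b - dist (\<iota> b) x \<le> c" for b
    unfolding c_def by (rule cSUP_upper[OF _ bddc]) simp
  have c_le: "c \<le> k" if "\<And>b. u b - dist (\<iota> b) x \<le> k" for k
    unfolding c_def using that by (intro cSUP_least) auto
  \<comment> \<open>McShane's formula again, now for the data \<open>u\<close> on \<open>E\<close>
    and \<open>c\<close> at \<open>x\<close>.\<close>
  define f where "f = (\<lambda>z. min (c + dist x z) (M z))"
  have "f z \<le> f w + dist z w" for z w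
  proof -
    have "M z - dist z w \<le> M w"
    proof (rule le_M)
      show "M z - dist z w \<le> u a + dist (\<iota> a) w" for a
        using M_le[of z a] dist_triangle2[of "\<iota> a" z w] by simp
    qed
    moreover have "dist x z \<le> dist x w + dist z w"
      by (rule dist_triangle2)
    ultimately show ?thesis by (auto simp: f_def)
  qed
  then have "\<bar>f z - f w\<bar> \<le> dist z w" for z w
    by (smt (verit) dist_commute)
  then have lip: "1-lipschitz_on UNIV f"
    by (intro lipschitz_onI) (auto simp: dist_real_def)
  have "f (\<iota> b) = u b" for b
  proof -
    have "M (\<iota> b) = u b"
      using u_tri[of b "\<iota> b"] M_le[of "\<iota> b" b] by (intro antisym le_M) auto
    then show ?thesis
      using c_ge[of b] by (simp add: f_def dist_commute)
  qed
  then have "f \<circ> \<iota> = u" by auto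
  moreover have "f x = c"
    using c_le[of "M x"] le_M u_tri by (force simp: f_def)
  moreover have "f y = c + D"
  proof -
    have "c \<le> u a + dist (\<iota> a) y - D" for a
      using sep[of a] by (intro c_le) (simp add: algebra_simps)
    then have "c + D \<le> M y"
      by (intro le_M) (simp add: algebra_simps)
    then show ?thesis by (simp add: f_def D_def)
  qed
  ultimately show thesis
    using lip lin_u by (intro that[of f]) (auto simp: Lip_ball_def Lip_over_def D_def)
qed

text \<open>A normed space is a metric space over itself via \<open>id\<close>, so
  \<open>Lip_ball_separates\<close> applies to 0 and \<open>w\<close>. The functional reduces
  estimates for vector-valued Lipschitz maps to real-valued ones.\<close>

lemma norming_functional:
  fixes w :: "'f::real_normed_vector"
  obtains g where "linear g" "\<And>v. \<bar>g v\<bar> \<le> norm v" "g w = norm w"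
proof -
  have "metric_space_over (id :: 'f \<Rightarrow> 'f)"
    using convex_on_dist[of UNIV] by (auto simp: metric_space_over_def isometric_map_def dist_commute)
  then obtain g :: "'f \<Rightarrow> real" where g: "g \<in> Lip_ball id" "g w - g 0 = dist 0 w"
    by (rule Lip_ball_separates)
  from g have lin: "linear g" and "1-lipschitz_on UNIV g"
    by (auto simp: Lip_ball_def Lip_over_def)
  then have "\<bar>g v\<bar> \<le> norm v" for v
    using lipschitz_onD[of 1 UNIV g v 0] linear_0[OF lin] by (simp add: dist_norm)
  then show thesis
    using lin g linear_0[OF lin] by (intro that[of g]) auto
qed

section \<open>Continuous linear maps on subspaces\<close>

lemma subspace_closure:
  fixes S :: "'a::real_normed_vector set"
  assumes "subspace S"
  shows "subspace (closure S)"
proof (rule subspaceI)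
  show "0 \<in> closure S"
    using subspace_0[OF assms] closure_subset by blast
next
  fix x y assume "x \<in> closure S" "y \<in> closure S"
  then obtain f g where "\<And>n. f n \<in> S" "f \<longlonglongrightarrow> x" "\<And>n. g n \<in> S" "g \<longlonglongrightarrow> y"
    unfolding closure_sequential by blast
  then have "\<And>n. f n + g n \<in> S" "(\<lambda>n. f n + g n) \<longlonglongrightarrow> x + y"
    using subspace_add[OF assms] by (auto intro: tendsto_add)
  then show "x + y \<in> closure S"
    unfolding closure_sequential by (intro exI[of _ "\<lambda>n. f n + g n"]) auto
next
  fix c :: real and x assume "x \<in> closure S"
  then obtain f where "\<And>n. f n \<in> S" "f \<longlonglongrightarrow> x"
    unfolding closure_sequential by blast
  then have "\<And>n. c *\<^sub>R f n \<in> S" "(\<lambda>n. c *\<^sub>R f n) \<longlonglongrightarrow> c *\<^sub>R x"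
    using subspace_scale[OF assms] by (auto intro: tendsto_scaleR)
  then show "c *\<^sub>R x \<in> closure S"
    unfolding closure_sequential by (intro exI[of _ "\<lambda>n. c *\<^sub>R f n"]) auto
qed

lemma linear_on_subspace_scaleR:
  assumes "subspace V" "linear_on_subspace V T" "v \<in> V"
  shows "T (c *\<^sub>R v) = c *\<^sub>R T v"
  using assms(2)[unfolded linear_on_subspace_def, rule_format, of v v c 0] assms by simp

lemma linear_on_subspace_add:
  assumes "linear_on_subspace V T" "u \<in> V" "v \<in> V"
  shows "T (u + v) = T u + T v"
  using assms(1)[unfolded linear_on_subspace_def, rule_format, of u v 1 1] assms by simp

lemma linear_on_subspace_diff:
  assumes "linear_on_subspace V T" "u \<in> V" "v \<in> V"
  shows "T (u - v) = T u - T v"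
  using assms(1)[unfolded linear_on_subspace_def, rule_format, of u v 1 "-1"] assms by simp

lemma linear_on_subspace_0:
  assumes "subspace V" "linear_on_subspace V T"
  shows "T 0 = 0"
  using linear_on_subspace_scaleR[OF assms subspace_0[OF assms(1)], of 0] by simp

lemma lipschitz_on_linear:
  assumes V: "subspace V" and T: "linear_on_subspace V T"
    and "0 \<le> C" "\<And>v. v \<in> V \<Longrightarrow> norm (T v) \<le> C * norm v"
  shows "C-lipschitz_on V T"
proof (rule lipschitz_onI)
  show "dist (T u) (T v) \<le> C * dist u v" if "u \<in> V" "v \<in> V" for u v
    using linear_on_subspace_diff[OF T that] assms(4)[of "u - v"] subspace_diff[OF V that]
    by (simp add: dist_norm)
qed fact

lemma continuous_linear_bounded:
  assumes V: "subspace V" and T: "linear_on_subspace V T" and cont: "continuous_on V T"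
  obtains K where "0 \<le> K" "\<And>v. v \<in> V \<Longrightarrow> norm (T v) \<le> K * norm v"
proof -
  have "0 \<in> V" by (rule subspace_0[OF V])
  then obtain d where d: "0 < d" "\<And>v. v \<in> V \<Longrightarrow> norm v < d \<Longrightarrow> norm (T v) < 1"
    using cont[unfolded continuous_on_iff, rule_format, of 0 1] linear_on_subspace_0[OF V T]
    by (auto simp: dist_norm)
  have "norm (T v) \<le> 2 / d * norm v" if v: "v \<in> V" for v
  proof (cases "v = 0")
    case False
    define c where "c = d / (2 * norm v)"
    have c: "0 < c" using False d by (simp add: c_def)
    have "norm (c *\<^sub>R v) < d" using False d by (simp add: c_def)
    then have "c * norm (T v) < 1"
      using d(2)[of "c *\<^sub>R v"] subspace_scale[OF V v] linear_on_subspace_scaleR[OF V T v] c by simp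
    then show ?thesis using False d by (simp add: c_def field_simps)
  qed (simp add: linear_on_subspace_0[OF V T])
  then show thesis using d by (intro that[of "2 / d"]) auto
qed

section \<open>Operator norms and Lipschitz constants\<close>

lemma onorm_on_le:
  assumes "V \<noteq> {}" "0 \<le> C" "\<And>v. v \<in> V \<Longrightarrow> norm (T v) \<le> C * norm v"
  shows "onorm_on V T \<le> C"
  unfolding onorm_on_def
proof (rule cSUP_least)
  show "norm (T v) / norm v \<le> C" if "v \<in> V" for v
    using assms(2) assms(3)[OF that] by (cases "v = 0") (auto simp: field_simps)
qed fact

lemma norm_le_onorm_on:
  assumes V: "subspace V" and T: "linear_on_subspace V T" "continuous_on V T" and v: "v \<in> V"
  shows "norm (T v) \<le> onorm_on V T * norm v"
proof -
  obtain K where K: "0 \<le> K" "\<And>v. v \<in> V \<Longrightarrow> norm (T v) \<le> K * norm v"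
    using continuous_linear_bounded[OF V T] by blast
  have "norm (T v) / norm v \<le> K" if "v \<in> V" for v
    using K(1) K(2)[OF that] by (cases "v = 0") (auto simp: field_simps)
  then have "norm (T v) / norm v \<le> onorm_on V T"
    unfolding onorm_on_def using v by (intro cSUP_upper bdd_aboveI[of _ K]) auto
  then show ?thesis
    using linear_on_subspace_0[OF V T(1)] by (cases "v = 0") (auto simp: field_simps)
qed

lemma onorm_on_nonneg:
  assumes V: "subspace V" and T: "linear_on_subspace V T" "continuous_on V T"
  shows "0 \<le> onorm_on V T"
proof -
  obtain K where K: "0 \<le> K" "\<And>v. v \<in> V \<Longrightarrow> norm (T v) \<le> K * norm v"
    using continuous_linear_bounded[OF V T] by blast
  have "norm (T v) / norm v \<le> K" if "v \<in> V" for v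
    using K(1) K(2)[OF that] by (cases "v = 0") (auto simp: field_simps)
  \<comment> \<open>The vector 0 contributes the quotient \<open>0 / 0 = 0\<close>, so the supremum
    is nonnegative also on the zero subspace.\<close>
  then have "norm (T 0) / norm (0 :: 'a) \<le> onorm_on V T"
    unfolding onorm_on_def using subspace_0[OF V] by (intro cSUP_upper bdd_aboveI[of _ K]) auto
  then show ?thesis by simp
qed

lemma lip_const_le: "C-lipschitz_on UNIV \<theta> \<Longrightarrow> lip_const \<theta> \<le> C"
  unfolding lip_const_def
  by (intro cInf_lower bdd_belowI[of _ 0]) (auto intro: lipschitz_on_nonneg)

text \<open>For \<open>x \<noteq> y\<close> the quotient
  \<open>dist (\<theta> x) (\<theta> y) / dist x y\<close> is a lower bound of all Lipschitz
  constants, hence at most their infimum: the infimum is attained.\<close>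

lemma lipschitz_on_lip_const:
  assumes "C-lipschitz_on UNIV \<theta>"
  shows "(lip_const \<theta>)-lipschitz_on UNIV \<theta>"
proof (rule lipschitz_onI)
  show "0 \<le> lip_const \<theta>"
    unfolding lip_const_def using assms
    by (intro cInf_greatest) (auto intro: lipschitz_on_nonneg)
  show "dist (\<theta> x) (\<theta> y) \<le> lip_const \<theta> * dist x y" for x y
  proof (cases "x = y")
    case False
    have "dist (\<theta> x) (\<theta> y) / dist x y \<le> lip_const \<theta>"
      unfolding lip_const_def using assms False
      by (intro cInf_greatest) (auto simp: divide_le_eq dest: lipschitz_onD)
    with False show ?thesis by (simp add: divide_le_eq)
  qed simp
qed

section \<open>Uniqueness and existence of extensions by continuity\<close>

text \<open>The vectors on which \<open>T\<close> and \<open>S\<close> agree form a closed subspace,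
  which therefore contains the closed span of \<open>A\<close>; off this span both maps are
  \<open>undefined\<close>.\<close>

lemma cont_linear_maps_eqI:
  assumes T: "T \<in> cont_linear_maps (closure (span A)) W"
    and S: "S \<in> cont_linear_maps (closure (span A)) W'"
    and eq: "\<And>a. a \<in> A \<Longrightarrow> T a = S a"
  shows "T = S"
proof -
  let ?V = "closure (span A)"
  let ?D = "{v \<in> ?V. T v - S v = 0}"
  have V: "subspace ?V" by (intro subspace_closure subspace_span)
  have lin: "linear_on_subspace ?V T" "linear_on_subspace ?V S"
    and ext: "T \<in> extensional ?V" "S \<in> extensional ?V"
    using T S by (auto simp: cont_linear_maps_def PiE_def)
  have "closed ?D"
    using T S by (intro continuous_closed_preimage_constant continuous_on_diff closed_closure)
      (auto simp: cont_linear_maps_def)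
  moreover have "subspace ?D"
  proof (rule subspaceI)
    show "0 \<in> ?D"
      using subspace_0[OF V] lin[THEN linear_on_subspace_0[OF V]] by simp
    show "u + v \<in> ?D" if "u \<in> ?D" "v \<in> ?D" for u v
      using that subspace_add[OF V] lin[THEN linear_on_subspace_add, of u v] by auto
    show "c *\<^sub>R v \<in> ?D" if "v \<in> ?D" for c v
      using that subspace_scale[OF V] lin[THEN linear_on_subspace_scaleR[OF V], of v c] by auto
  qed
  moreover have "A \<subseteq> ?D"
    using eq span_superset closure_subset by fastforce
  ultimately have "?V \<subseteq> ?D"
    by (intro closure_minimal span_minimal)
  then show ?thesis
    by (intro extensionalityI[OF ext]) auto
qed

text \<open>A linear relation \<open>G\<close> takes the place of a map on a span, whose
  well-definedness would have to be shown first. The bound passes to the closure of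
  \<open>G\<close>; it makes the closure single-valued and, by completeness of \<open>W\<close>,
  defined on the whole closure of the domain.\<close>

lemma bounded_graph_extension:
  fixes G :: "('b::real_normed_vector \<times> 'f::real_normed_vector) set"
  assumes G: "subspace G" and W: "snd ` G \<subseteq> W" "complete W"
    and bound: "\<And>u w. (u, w) \<in> G \<Longrightarrow> norm w \<le> C * norm u" and "0 \<le> C"
  obtains T where "T \<in> cont_linear_maps (closure (fst ` G)) W"
    "\<And>u w. (u, w) \<in> G \<Longrightarrow> T u = w"
    "\<And>u. u \<in> closure (fst ` G) \<Longrightarrow> norm (T u) \<le> C * norm u"
proof -
  let ?V = "closure (fst ` G)"
  let ?H = "closure G"
  have H: "subspace ?H" by (rule subspace_closure[OF G])
  have "?H \<subseteq> {p. norm (snd p) \<le> C * norm (fst p)}"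
    using bound by (intro closure_minimal closed_Collect_le continuous_intros) auto
  then have Hb: "norm w \<le> C * norm u" if "(u, w) \<in> ?H" for u w
    using that by auto
  have "?H \<subseteq> UNIV \<times> W"
  proof (rule closure_minimal)
    show "G \<subseteq> UNIV \<times> W" using W(1) by auto
    show "closed (UNIV \<times> W :: ('b \<times> 'f) set)"
      using W(2) by (intro closed_Times closed_UNIV complete_imp_closed)
  qed
  then have HW: "w \<in> W" if "(u, w) \<in> ?H" for u w
    using that by auto
  \<comment> \<open>By linearity \<open>(0, w - w')\<close> lies in the closed relation, and the
    bound forces its second entry to be 0.\<close>
  have uniq: "w = w'" if "(u, w) \<in> ?H" "(u, w') \<in> ?H" for u w w'
    using Hb[of 0 "w - w'"] subspace_diff[OF H that] by simp
  have ex: "\<exists>w. (u, w) \<in> ?H" if "u \<in> ?V" for u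
  proof -
    obtain a where a: "\<And>n. a n \<in> fst ` G" "a \<longlonglongrightarrow> u"
      using \<open>u \<in> ?V\<close> unfolding closure_sequential by blast
    then have "\<forall>n. \<exists>w. (a n, w) \<in> G" by force
    then obtain b where b: "\<And>n. (a n, b n) \<in> G" by metis
    have le: "dist (b m) (b n) \<le> C * dist (a m) (a n)" for m n
      using bound[of "a m - a n" "b m - b n"] subspace_diff[OF G b b, of m n] by (simp add: dist_norm)
    have "Cauchy b"
    proof (rule metric_CauchyI)
      fix e :: real assume "0 < e"
      \<comment> \<open>Dividing by \<open>C + 1\<close> rather than \<open>C\<close> covers the
        case \<open>C = 0\<close>.\<close>
      then obtain M where M: "\<And>m n. m \<ge> M \<Longrightarrow> n \<ge> M \<Longrightarrow> dist (a m) (a n) < e / (C + 1)"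
        using metric_CauchyD[OF LIMSEQ_imp_Cauchy[OF a(2)], of "e / (C + 1)"] \<open>0 \<le> C\<close> by auto
      have "dist (b m) (b n) < e" if "m \<ge> M" "n \<ge> M" for m n
      proof -
        have "dist (b m) (b n) \<le> (C + 1) * dist (a m) (a n)"
          using le[of m n] by (simp add: distrib_right add_increasing2)
        also have "\<dots> < e"
          using M[OF that] \<open>0 \<le> C\<close> by (simp add: field_simps)
        finally show ?thesis .
      qed
      then show "\<exists>M. \<forall>m\<ge>M. \<forall>n\<ge>M. dist (b m) (b n) < e" by blast
    qed
    moreover have "b n \<in> W" for n
      using b W by force
    ultimately obtain w where "b \<longlonglongrightarrow> w"
      using W(2) unfolding complete_def by blast
    then have "(\<lambda>n. (a n, b n)) \<longlonglongrightarrow> (u, w)"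
      by (intro tendsto_Pair a)
    then show ?thesis
      using b unfolding closure_sequential by (intro exI[of _ w] exI[of _ "\<lambda>n. (a n, b n)"]) auto
  qed
  define T where "T = (\<lambda>u\<in>?V. THE w. (u, w) \<in> ?H)"
  have T_eq: "T u = w" if "(u, w) \<in> ?H" "u \<in> ?V" for u w
    using that uniq by (auto simp: T_def)
  have T_in: "(u, T u) \<in> ?H" if "u \<in> ?V" for u
    using ex[OF that] T_eq[OF _ that] by auto
  have V: "subspace ?V"
    by (intro subspace_closure linear_subspace_image bounded_linear.linear bounded_linear_fst G)
  have lin: "linear_on_subspace ?V T"
    unfolding linear_on_subspace_def
  proof (intro ballI allI)
    fix u v a b assume uv: "u \<in> ?V" "v \<in> ?V"
    have "a *\<^sub>R (u, T u) + b *\<^sub>R (v, T v) \<in> ?H"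
      using uv by (intro subspace_add subspace_scale H T_in)
    then show "T (a *\<^sub>R u + b *\<^sub>R v) = a *\<^sub>R T u + b *\<^sub>R T v"
      using uv by (intro T_eq subspace_add subspace_scale V) auto
  qed
  show thesis
  proof
    show bd: "norm (T u) \<le> C * norm u" if "u \<in> ?V" for u
      using Hb T_in that by blast
    show "T u = w" if "(u, w) \<in> G" for u w
      using that closure_subset[of G] closure_subset[of "fst ` G"] by (intro T_eq) (auto intro: rev_image_eqI)
    show "T \<in> cont_linear_maps ?V W"
      using T_in HW lin lipschitz_on_continuous_on[OF lipschitz_on_linear[OF V lin \<open>0 \<le> C\<close> bd]]
      by (auto simp: cont_linear_maps_def T_def)
  qed
qed

section \<open>The universal property\<close>

lemma apply_AE_emb_discrete:
  "f \<in> Lip_ball \<iota> \<Longrightarrow> apply_bcontfun (AE_emb \<iota> x) (discrete f) = f x"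
  by (simp add: apply_AE_emb discrete_inverse)

lemma subspace_AE_space: "subspace (AE_space \<iota>)"
  unfolding AE_space_def by (intro subspace_closure subspace_span)

lemma AE_emb_in_AE_space: "AE_emb \<iota> x \<in> AE_space \<iota>"
  unfolding AE_space_def by (intro subsetD[OF closure_subset] span_base rangeI)

lemma AE_space_eqI:
  assumes "T \<in> cont_linear_maps (AE_space \<iota>) W" "S \<in> cont_linear_maps (AE_space \<iota>) W'"
    and eq: "\<And>x. T (AE_emb \<iota> x) = S (AE_emb \<iota> x)"
  shows "T = S"
proof (rule cont_linear_maps_eqI)
  show "T a = S a" if "a \<in> range (AE_emb \<iota>)" for a
    using that eq by auto
qed (use assms in \<open>simp_all add: AE_space_def\<close>)

text \<open>Every coordinate \<open>f\<close> in \<open>Lip_ball\<close> is 1-Lipschitz and linear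
  on \<open>E\<close>, and the supremum norm passes both properties on to the embedding. The reverse
  inequality for distances comes from a single coordinate, one that separates \<open>x\<close> from
  \<open>y\<close>.\<close>

lemma AE_space_banach_extension:
  assumes over: "metric_space_over \<iota>"
  shows "banach_extension \<iota> (AE_space \<iota>) (AE_emb \<iota>)"
  unfolding banach_extension_def
proof (intro conjI)
  show "banach_space_on (AE_space \<iota>)"
    unfolding banach_space_on_def complete_eq_closed
    by (simp add: subspace_AE_space) (simp add: AE_space_def)
  show "range (AE_emb \<iota>) \<subseteq> AE_space \<iota>"
    using AE_emb_in_AE_space by auto
  show "isometric_map (AE_emb \<iota>)"
    unfolding isometric_map_def
  proof (intro allI antisym)
    fix x y
    show "dist (AE_emb \<iota> x) (AE_emb \<iota> y) \<le> dist x y"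
    proof (rule dist_bound)
      show "dist (apply_bcontfun (AE_emb \<iota> x) f) (apply_bcontfun (AE_emb \<iota> y) f) \<le> dist x y" for f
      proof (cases "of_discrete f \<in> Lip_ball \<iota>")
        case True
        then have "1-lipschitz_on UNIV (of_discrete f)" by (simp add: Lip_ball_def)
        from lipschitz_onD[OF this, of x y] True show ?thesis by (simp add: apply_AE_emb)
      qed (simp add: apply_AE_emb)
    qed
    obtain f where f: "f \<in> Lip_ball \<iota>" "f y - f x = dist x y"
      using Lip_ball_separates[OF over] by blast
    then show "dist x y \<le> dist (AE_emb \<iota> x) (AE_emb \<iota> y)"
      using dist_bounded[of "AE_emb \<iota> x" "discrete f" "AE_emb \<iota> y"]
      unfolding apply_AE_emb_discrete[OF f(1)] by (simp add: dist_real_def)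
  qed
  have lin: "linear (f \<circ> \<iota>)" if "f \<in> Lip_ball \<iota>" for f
    using that by (simp add: Lip_ball_def Lip_over_def)
  show "linear (AE_emb \<iota> \<circ> \<iota>)"
  proof (rule linearI)
    fix a b show "(AE_emb \<iota> \<circ> \<iota>) (a + b) = (AE_emb \<iota> \<circ> \<iota>) a + (AE_emb \<iota> \<circ> \<iota>) b"
    proof (rule bcontfun_eqI)
      show "apply_bcontfun ((AE_emb \<iota> \<circ> \<iota>) (a + b)) f
          = apply_bcontfun ((AE_emb \<iota> \<circ> \<iota>) a + (AE_emb \<iota> \<circ> \<iota>) b) f" for f
        using linear_add[OF lin, of "of_discrete f" a b]
        by (simp add: apply_AE_emb plus_bcontfun.rep_eq)
    qed
  next
    fix c b show "(AE_emb \<iota> \<circ> \<iota>) (c *\<^sub>R b) = c *\<^sub>R (AE_emb \<iota> \<circ> \<iota>) b"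
    proof (rule bcontfun_eqI)
      show "apply_bcontfun ((AE_emb \<iota> \<circ> \<iota>) (c *\<^sub>R b)) f
          = apply_bcontfun (c *\<^sub>R (AE_emb \<iota> \<circ> \<iota>) b) f" for f
        using linear_cmul[OF lin, of "of_discrete f" c b]
        by (simp add: apply_AE_emb scaleR_bcontfun.rep_eq)
    qed
  qed
qed

text \<open>\<open>G\<close> relates each finite combination of points \<open>x\<close> to the same
  combination of the values \<open>\<theta> x\<close>. Once \<open>bound\<close> is known,
  \<open>bounded_graph_extension\<close> gives the extension with its norm estimate; uniqueness
  holds because the image of \<open>X\<close> spans a dense subspace.\<close>

lemma AE_space_universal:
  "AE_universal TYPE('f::real_normed_vector) \<iota> (AE_space \<iota>) (AE_emb \<iota>)"
  unfolding AE_universal_def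
proof (intro allI impI ballI conjI)
  fix W :: "'f set" and \<theta>
  assume W: "banach_space_on W" and \<theta>: "\<theta> \<in> Lip_over \<iota> W"
  define C where "C = lip_const \<theta>"
  have lip: "C-lipschitz_on UNIV \<theta>" and lin: "linear (\<theta> \<circ> \<iota>)" and ran: "range \<theta> \<subseteq> W"
    using \<theta> lipschitz_on_lip_const by (auto simp: Lip_over_def C_def)
  have C: "0 \<le> C" by (rule lipschitz_on_nonneg[OF lip])
  define G where "G = span (range (\<lambda>x. (AE_emb \<iota> x, \<theta> x)))"
  have fstG: "fst ` G = span (range (AE_emb \<iota>))"
    unfolding G_def by (simp add: linear_span_image[OF linear_fst, symmetric] image_image)
  have sndG: "snd ` G \<subseteq> W"
  proof -
    have "snd ` G = span (range \<theta>)"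
      unfolding G_def by (simp add: linear_span_image[OF linear_snd, symmetric] image_image)
    then show ?thesis
      using W ran by (simp add: banach_space_on_def span_minimal)
  qed
  \<comment> \<open>\<open>C'\<close> is positive even if \<open>C = 0\<close>, so division by it is
    harmless; \<open>C\<close> itself is reached afterwards by letting \<open>C'\<close> decrease to
    it.\<close>
  have bound': "norm w \<le> C' * norm u" if uw: "(u, w) \<in> G" and "C < C'" for u w C'
  proof -
    have C': "0 < C'" using that C by simp
    \<comment> \<open>\<open>g\<close> norms only the given \<open>w\<close>; its composition with
      \<open>\<theta>\<close>, scaled by \<open>1 / C'\<close>, is one of the coordinates of the
      witness space.\<close>
    obtain g where g: "linear g" "\<And>v. \<bar>g v\<bar> \<le> norm v" "g w = norm w"
      using norming_functional by blast
    define f where "f = (\<lambda>x. g (\<theta> x) / C')"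
    have "\<bar>f x - f y\<bar> \<le> dist x y" for x y
    proof -
      have "f x - f y = g (\<theta> x - \<theta> y) / C'"
        using linear_diff[OF g(1)] by (simp add: f_def diff_divide_distrib)
      then have "\<bar>f x - f y\<bar> \<le> norm (\<theta> x - \<theta> y) / C'"
        using g(2) C' by (simp add: abs_divide divide_right_mono)
      also have "\<dots> \<le> C' * dist x y / C'"
        using lipschitz_onD[OF lip, of x y] \<open>C < C'\<close> C' mult_right_mono[of C C' "dist x y"]
        by (intro divide_right_mono) (auto simp: dist_norm)
      finally show ?thesis using C' by simp
    qed
    then have "1-lipschitz_on UNIV f"
      by (intro lipschitz_onI) (auto simp: dist_real_def)
    moreover have "linear (f \<circ> \<iota>)"
    proof -
      have "linear (\<lambda>a. (1 / C') *\<^sub>R (g \<circ> (\<theta> \<circ> \<iota>)) a)"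
        by (intro linear_compose_scale_right linear_compose lin g)
      moreover have "(\<lambda>a. (1 / C') *\<^sub>R (g \<circ> (\<theta> \<circ> \<iota>)) a) = f \<circ> \<iota>"
        by (auto simp: f_def)
      ultimately show ?thesis by simp
    qed
    ultimately have f: "f \<in> Lip_ball \<iota>"
      by (auto simp: Lip_ball_def Lip_over_def)
    \<comment> \<open>This functional vanishes on the generating pairs and hence on all of
      \<open>G\<close>, which carries the identity \<open>g (\<theta> x) = C' * f x\<close> over to
      linear combinations.\<close>
    let ?h = "\<lambda>p. g (snd p) - C' * apply_bcontfun (fst p) (discrete f)"
    have "linear ?h"
      by (rule linearI)
        (simp_all add: linear_add[OF g(1)] linear_cmul[OF g(1)] plus_bcontfun.rep_eq
          scaleR_bcontfun.rep_eq algebra_simps)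
    moreover have "C' * apply_bcontfun (AE_emb \<iota> x) (discrete f) = g (\<theta> x)" for x
      unfolding apply_AE_emb_discrete[OF f] using C' by (simp add: f_def)
    then have "?h p = 0" if "p \<in> range (\<lambda>x. (AE_emb \<iota> x, \<theta> x))" for p
      using that by auto
    ultimately have "?h (u, w) = 0"
      using uw unfolding G_def by (rule linear_eq_0_on_span)
    then have "norm w = C' * apply_bcontfun u (discrete f)"
      by (simp add: g)
    also have "\<dots> \<le> C' * norm u"
      using norm_bounded[of u "discrete f"] C' by (intro mult_left_mono) auto
    finally show ?thesis .
  qed
  have bound: "norm w \<le> C * norm u" if uw: "(u, w) \<in> G" for u w
  proof (cases "u = 0")
    case False
    have "norm w / norm u \<le> C'" if "C < C'" for C'
      using bound'[OF uw that] False by (simp add: divide_le_eq)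
    then have "norm w / norm u \<le> C" by (rule dense_ge)
    with False show ?thesis by (simp add: divide_le_eq)
  qed (use bound'[OF uw, of "C + 1"] in simp)
  obtain T where T: "T \<in> cont_linear_maps (AE_space \<iota>) W"
    and TG: "\<And>u w. (u, w) \<in> G \<Longrightarrow> T u = w"
    and T_le: "\<And>u. u \<in> AE_space \<iota> \<Longrightarrow> norm (T u) \<le> C * norm u"
  proof -
    have "subspace G" "complete W"
      using W by (auto simp: G_def banach_space_on_def)
    then show thesis
      using bounded_graph_extension[OF _ sndG _ bound C] that
      unfolding fstG AE_space_def by blast
  qed
  have Tj: "T (AE_emb \<iota> x) = \<theta> x" for x
    by (intro TG) (auto simp: G_def intro: span_base)
  have uniq: "S = T" if "S \<in> cont_linear_maps (AE_space \<iota>) W \<and> (\<forall>x. S (AE_emb \<iota> x) = \<theta> x)" for S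
    by (rule AE_space_eqI[of S \<iota> W T W]) (use that T Tj in auto)
  show "\<exists>!\<theta>'. \<theta>' \<in> cont_linear_maps (AE_space \<iota>) W \<and> (\<forall>x. \<theta>' (AE_emb \<iota> x) = \<theta> x)"
    using T Tj uniq by blast
  show "onorm_on (AE_space \<iota>) \<theta>' \<le> lip_const \<theta>"
    if "\<theta>' \<in> cont_linear_maps (AE_space \<iota>) W \<and> (\<forall>x. \<theta>' (AE_emb \<iota> x) = \<theta> x)" for \<theta>'
    using uniq[OF that] T_le C AE_emb_in_AE_space unfolding C_def by (intro onorm_on_le) auto
qed

section \<open>Uniqueness and duality\<close>

lemma isometric_isomorphism_cont_linear:
  assumes "subspace V" "isometric_isomorphism V W \<Phi>"
  shows "\<Phi> \<in> cont_linear_maps V W"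
proof -
  have \<Phi>: "\<Phi> \<in> extensional V" "linear_on_subspace V \<Phi>" "\<Phi> ` V = W"
    "\<And>v. v \<in> V \<Longrightarrow> norm (\<Phi> v) = norm v"
    using assms(2) by (auto simp: isometric_isomorphism_def)
  have "1-lipschitz_on V \<Phi>"
    by (rule lipschitz_on_linear[OF assms(1) \<Phi>(2)]) (simp_all add: \<Phi>(4))
  moreover have "\<Phi> \<in> V \<rightarrow>\<^sub>E W"
    using \<Phi>(1,3) by (auto simp: PiE_def)
  ultimately show ?thesis
    using \<Phi>(2) by (simp add: cont_linear_maps_def lipschitz_on_continuous_on)
qed

lemma cont_linear_maps_compose:
  assumes S: "S \<in> cont_linear_maps U V" and T: "T \<in> cont_linear_maps V W" and U: "subspace U"
  shows "(\<lambda>u\<in>U. T (S u)) \<in> cont_linear_maps U W"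
proof -
  have SV: "S u \<in> V" if "u \<in> U" for u
    using S that by (auto simp: cont_linear_maps_def)
  have "continuous_on U (\<lambda>u. T (S u))"
  proof (rule continuous_on_compose2[of V T U S])
    show "continuous_on V T" "continuous_on U S"
      using S T by (simp_all add: cont_linear_maps_def)
  qed (use SV in auto)
  moreover have "linear_on_subspace U (\<lambda>u\<in>U. T (S u))"
    unfolding linear_on_subspace_def
  proof (intro ballI allI)
    fix u v a b assume uv: "u \<in> U" "v \<in> U"
    have mem: "a *\<^sub>R u + b *\<^sub>R v \<in> U"
      using uv by (intro subspace_add subspace_scale U)
    have "T (S (a *\<^sub>R u + b *\<^sub>R v)) = T (a *\<^sub>R S u + b *\<^sub>R S v)"
      using S uv by (simp add: cont_linear_maps_def linear_on_subspace_def)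
    also have "\<dots> = a *\<^sub>R T (S u) + b *\<^sub>R T (S v)"
      using T SV[OF uv(1)] SV[OF uv(2)] by (simp add: cont_linear_maps_def linear_on_subspace_def)
    finally show "(\<lambda>u\<in>U. T (S u)) (a *\<^sub>R u + b *\<^sub>R v)
        = a *\<^sub>R (\<lambda>u\<in>U. T (S u)) u + b *\<^sub>R (\<lambda>u\<in>U. T (S u)) v"
      using uv mem by simp
  qed
  moreover have "(\<lambda>u\<in>U. T (S u)) \<in> U \<rightarrow>\<^sub>E W"
    using T SV by (auto simp: cont_linear_maps_def)
  ultimately show ?thesis
    by (simp add: cont_linear_maps_def)
qed

lemma isometric_isomorphism_inverse:
  assumes V: "subspace V" and \<Phi>: "isometric_isomorphism V W \<Phi>"
  shows "\<exists>\<Psi>\<in>cont_linear_maps W V. (\<forall>v\<in>V. \<Psi> (\<Phi> v) = v) \<and> (\<forall>w\<in>W. \<Phi> (\<Psi> w) = w)"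
proof -
  have lin: "linear_on_subspace V \<Phi>" and img: "\<Phi> ` V = W"
    and iso: "\<And>v. v \<in> V \<Longrightarrow> norm (\<Phi> v) = norm v"
    using \<Phi> by (auto simp: isometric_isomorphism_def)
  have dist: "norm (\<Phi> u - \<Phi> v) = norm (u - v)" if "u \<in> V" "v \<in> V" for u v
    using iso[of "u - v"] linear_on_subspace_diff[OF lin that] subspace_diff[OF V that] by simp
  then have inj: "inj_on \<Phi> V"
    by (intro inj_onI) (metis eq_iff_diff_eq_0 norm_eq_zero)
  define \<Psi> where "\<Psi> = (\<lambda>w\<in>W. inv_into V \<Phi> w)"
  have left: "\<Psi> (\<Phi> v) = v" if "v \<in> V" for v
    using that inj img by (auto simp: \<Psi>_def)
  have right: "\<Phi> (\<Psi> w) = w" and mem: "\<Psi> w \<in> V" if "w \<in> W" for w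
    using that left img by auto
  have "linear_on_subspace W \<Psi>"
    unfolding linear_on_subspace_def
  proof (intro ballI allI)
    fix w z a b assume wz: "w \<in> W" "z \<in> W"
    have "\<Phi> (a *\<^sub>R \<Psi> w + b *\<^sub>R \<Psi> z) = a *\<^sub>R w + b *\<^sub>R z"
      using lin mem right wz by (simp add: linear_on_subspace_def)
    moreover have "a *\<^sub>R \<Psi> w + b *\<^sub>R \<Psi> z \<in> V"
      using mem wz by (intro subspace_add subspace_scale V)
    ultimately show "\<Psi> (a *\<^sub>R w + b *\<^sub>R z) = a *\<^sub>R \<Psi> w + b *\<^sub>R \<Psi> z"
      using left by metis
  qed
  moreover have "continuous_on W \<Psi>"
  proof (rule lipschitz_on_continuous_on[of 1], rule lipschitz_onI)
    show "dist (\<Psi> w) (\<Psi> z) \<le> 1 * dist w z" if "w \<in> W" "z \<in> W" for w z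
      using dist[of "\<Psi> w" "\<Psi> z"] mem right that by (simp add: dist_norm)
  qed simp
  ultimately have "\<Psi> \<in> cont_linear_maps W V"
    using mem by (auto simp: cont_linear_maps_def \<Psi>_def)
  then show ?thesis using left right by blast
qed

text \<open>Each of two embeddings can thus be extended by the universal property of the other, and
  the constant 1 makes the resulting linear maps contractions.\<close>

lemma banach_extension_Lip_over:
  assumes "banach_extension \<iota> B j"
  shows "j \<in> Lip_over \<iota> B" "lip_const j \<le> 1"
proof -
  have "1-lipschitz_on UNIV j"
    using assms by (intro lipschitz_onI) (auto simp: banach_extension_def isometric_map_def)
  then show "j \<in> Lip_over \<iota> B" "lip_const j \<le> 1"
    using assms by (auto simp: Lip_over_def banach_extension_def intro: lip_const_le)
qed

lemma AE_universal_extension: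
  assumes univ: "AE_universal TYPE('f::real_normed_vector) \<iota> B j" and B: "subspace B"
    and W: "banach_space_on (W :: 'f set)" and \<theta>: "\<theta> \<in> Lip_over \<iota> W"
  shows "\<exists>T\<in>cont_linear_maps B W. (\<forall>x. T (j x) = \<theta> x) \<and>
    (\<forall>v\<in>B. norm (T v) \<le> lip_const \<theta> * norm v)"
proof -
  obtain T where T: "T \<in> cont_linear_maps B W" "\<forall>x. T (j x) = \<theta> x"
    using univ W \<theta> unfolding AE_universal_def by blast
  have le: "onorm_on B T \<le> lip_const \<theta>"
    using univ W \<theta> T unfolding AE_universal_def by blast
  have "norm (T v) \<le> lip_const \<theta> * norm v" if "v \<in> B" for v
  proof -
    have "norm (T v) \<le> onorm_on B T * norm v"
      using T(1) that by (intro norm_le_onorm_on B) (auto simp: cont_linear_maps_def)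
    also have "\<dots> \<le> lip_const \<theta> * norm v"
      by (rule mult_right_mono[OF le]) simp
    finally show ?thesis .
  qed
  with T show ?thesis by blast
qed

lemma AE_universal_unique:
  assumes univ: "AE_universal TYPE('f::real_normed_vector) \<iota> B j"
    and W: "banach_space_on (W :: 'f set)" and \<theta>: "\<theta> \<in> Lip_over \<iota> W"
    and T: "T \<in> cont_linear_maps B W" "\<forall>x. T (j x) = \<theta> x"
    and S: "S \<in> cont_linear_maps B W" "\<forall>x. S (j x) = \<theta> x"
  shows "S = T"
proof -
  have "\<exists>!T. T \<in> cont_linear_maps B W \<and> (\<forall>x. T (j x) = \<theta> x)"
    using univ W \<theta> unfolding AE_universal_def by blast
  with T S show ?thesis by blast
qed

text \<open>Extending each embedding along the other gives linear contractions \<open>\<Phi>\<close>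
  and \<open>\<Psi>\<close>. Both composites fix the image of \<open>X\<close>, so they are
  identities by uniqueness of extensions, and mutually inverse contractions preserve norms.\<close>

lemma AE_space_unique:
  fixes \<iota> :: "'e::real_normed_vector \<Rightarrow> 'x::metric_space"
    and B :: "'b::real_normed_vector set"
  assumes over: "metric_space_over \<iota>" and ext: "banach_extension \<iota> B j"
    and univ: "AE_universal TYPE('b) \<iota> B j" "AE_universal TYPE('x ae_type) \<iota> B j"
  shows "\<exists>!\<Phi>. isometric_isomorphism (AE_space \<iota>) B \<Phi> \<and> (\<forall>x. \<Phi> (AE_emb \<iota> x) = j x)"
proof -
  let ?A = "AE_space \<iota>" and ?i = "AE_emb \<iota>"
  have extA: "banach_extension \<iota> ?A ?i"
    by (rule AE_space_banach_extension[OF over])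
  have bB: "banach_space_on B" and bA: "banach_space_on ?A"
    using ext extA by (auto simp: banach_extension_def)
  then have B: "subspace B" and A: "subspace ?A"
    by (auto simp: banach_space_on_def)
  have jB: "j x \<in> B" for x
    using ext by (auto simp: banach_extension_def)
  obtain \<Phi> where \<Phi>: "\<Phi> \<in> cont_linear_maps ?A B" "\<And>x. \<Phi> (?i x) = j x"
      "\<And>v. v \<in> ?A \<Longrightarrow> norm (\<Phi> v) \<le> lip_const j * norm v"
    using AE_universal_extension[OF AE_space_universal A bB banach_extension_Lip_over(1)[OF ext]]
    by auto
  obtain \<Psi> where \<Psi>: "\<Psi> \<in> cont_linear_maps B ?A" "\<And>x. \<Psi> (j x) = ?i x"
      "\<And>v. v \<in> B \<Longrightarrow> norm (\<Psi> v) \<le> lip_const ?i * norm v"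
    using AE_universal_extension[OF univ(2) B bA banach_extension_Lip_over(1)[OF extA]] by auto
  have \<Phi>_mem: "\<Phi> v \<in> B" if "v \<in> ?A" for v
    using \<Phi> that by (auto simp: cont_linear_maps_def)
  have \<Psi>_mem: "\<Psi> v \<in> ?A" if "v \<in> B" for v
    using \<Psi> that by (auto simp: cont_linear_maps_def)
  have id: "(\<lambda>v\<in>V. v) \<in> cont_linear_maps V V" if "subspace V" for V :: "'z::real_normed_vector set"
  proof -
    have "linear_on_subspace V (\<lambda>v\<in>V. v)"
      unfolding linear_on_subspace_def using subspace_add[OF that] subspace_scale[OF that] by simp
    then show ?thesis by (simp add: cont_linear_maps_def)
  qed
  have "(\<lambda>v\<in>?A. \<Psi> (\<Phi> v)) = (\<lambda>v\<in>?A. v)"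
  proof (rule AE_space_eqI[OF cont_linear_maps_compose[OF \<Phi>(1) \<Psi>(1) A] id[OF A]])
    show "(\<lambda>v\<in>?A. \<Psi> (\<Phi> v)) (?i x) = (\<lambda>v\<in>?A. v) (?i x)" for x
      by (simp add: AE_emb_in_AE_space \<Phi>(2) \<Psi>(2))
  qed
  from fun_cong[OF this] have \<Psi>\<Phi>: "\<Psi> (\<Phi> v) = v" if "v \<in> ?A" for v
    using that by (metis restrict_apply')
  \<comment> \<open>\<open>B\<close> is not given as the closed span of the image of
    \<open>j\<close>, so the uniqueness clause for \<open>j\<close> itself, with target
    \<open>B\<close>, replaces the density argument used for \<open>AE_space\<close>.\<close>
  have "(\<lambda>v\<in>B. \<Phi> (\<Psi> v)) = (\<lambda>v\<in>B. v)"
  proof (rule AE_universal_unique[OF univ(1) bB banach_extension_Lip_over(1)[OF ext] id[OF B] _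
        cont_linear_maps_compose[OF \<Psi>(1) \<Phi>(1) B]])
    show "\<forall>x. (\<lambda>v\<in>B. v) (j x) = j x" "\<forall>x. (\<lambda>v\<in>B. \<Phi> (\<Psi> v)) (j x) = j x"
      by (simp_all add: jB \<Phi>(2) \<Psi>(2))
  qed
  from fun_cong[OF this] have \<Phi>\<Psi>: "\<Phi> (\<Psi> v) = v" if "v \<in> B" for v
    using that by (metis restrict_apply')
  have le: "norm (\<Phi> v) \<le> norm v" if "v \<in> ?A" for v
    using \<Phi>(3)[OF that] mult_right_mono[OF banach_extension_Lip_over(2)[OF ext], of "norm v"] by simp
  have le': "norm (\<Psi> v) \<le> norm v" if "v \<in> B" for v
    using \<Psi>(3)[OF that] mult_right_mono[OF banach_extension_Lip_over(2)[OF extA], of "norm v"] by simp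
  have "norm (\<Phi> v) = norm v" if "v \<in> ?A" for v
    using le[OF that] le'[OF \<Phi>_mem[OF that]] \<Psi>\<Phi>[OF that] by simp
  moreover have "\<Phi> ` ?A = B"
  proof (intro equalityI subsetI)
    show "v \<in> \<Phi> ` ?A" if "v \<in> B" for v
      using \<Phi>\<Psi>[OF that] \<Psi>_mem[OF that] by (intro image_eqI[of _ _ "\<Psi> v"]) auto
  qed (use \<Phi>_mem in auto)
  ultimately have "isometric_isomorphism ?A B \<Phi>"
    using \<Phi>(1) by (simp add: isometric_isomorphism_def cont_linear_maps_def PiE_def)
  then show ?thesis
  proof (intro ex1I[of _ \<Phi>] conjI allI \<Phi>(2))
    show "S = \<Phi>" if "isometric_isomorphism ?A B S \<and> (\<forall>x. S (?i x) = j x)" for S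
    proof (rule AE_space_eqI)
      show "S \<in> cont_linear_maps ?A B"
        using that by (intro isometric_isomorphism_cont_linear[OF A]) simp
      show "S (?i x) = \<Phi> (?i x)" for x
        using that \<Phi>(2) by simp
    qed (rule \<Phi>(1))
  qed assumption
qed

section \<open>Transport of the universal property to isometric copies\<close>

lemma banach_extension_isometric_isomorphism:
  assumes ext: "banach_extension \<iota> A i" and B: "banach_space_on B"
    and \<Phi>: "isometric_isomorphism A B \<Phi>"
  shows "banach_extension \<iota> B (\<Phi> \<circ> i)"
proof -
  have A: "subspace A" and iA: "i x \<in> A" and iso: "dist (i x) (i y) = dist x y"
    and lin: "linear (i \<circ> \<iota>)" for x y
    using ext by (auto simp: banach_extension_def banach_space_on_def isometric_map_def)
  have lin\<Phi>: "linear_on_subspace A \<Phi>" and img: "\<Phi> ` A = B"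
    and norm\<Phi>: "\<And>v. v \<in> A \<Longrightarrow> norm (\<Phi> v) = norm v"
    using \<Phi> by (auto simp: isometric_isomorphism_def)
  have "dist (\<Phi> (i x)) (\<Phi> (i y)) = dist x y" for x y
    using norm\<Phi>[of "i x - i y"] iso[of x y] subspace_diff[OF A iA iA]
    by (simp add: dist_norm linear_on_subspace_diff[OF lin\<Phi> iA iA])
  moreover have "linear (\<Phi> \<circ> i \<circ> \<iota>)"
    using linear_add[OF lin] linear_cmul[OF lin] iA
    by (intro linearI) (auto simp: linear_on_subspace_add[OF lin\<Phi>] linear_on_subspace_scaleR[OF A lin\<Phi>])
  ultimately show ?thesis
    using B img iA by (auto simp: banach_extension_def isometric_map_def)
qed

text \<open>Composition with \<open>\<Phi>\<close> and with its inverse matches the extensions of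
  \<open>\<theta>\<close> to \<open>A\<close> with those to \<open>B\<close>; the norm bound
  survives because \<open>\<Phi>\<close> preserves norms.\<close>

lemma AE_universal_isometric_isomorphism:
  assumes univ: "AE_universal TYPE('f::real_normed_vector) \<iota> A i"
    and A: "subspace A" and iA: "range i \<subseteq> A" and B: "subspace B"
    and \<Phi>: "isometric_isomorphism A B \<Phi>"
  shows "AE_universal TYPE('f) \<iota> B (\<Phi> \<circ> i)"
  unfolding AE_universal_def
proof (intro allI impI ballI conjI)
  fix W :: "'f set" and \<theta>
  assume W: "banach_space_on W" and \<theta>: "\<theta> \<in> Lip_over \<iota> W"
  obtain \<Psi> where \<Psi>: "\<Psi> \<in> cont_linear_maps B A" "\<And>v. v \<in> A \<Longrightarrow> \<Psi> (\<Phi> v) = v"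
    "\<And>w. w \<in> B \<Longrightarrow> \<Phi> (\<Psi> w) = w"
    using isometric_isomorphism_inverse[OF A \<Phi>] by auto
  have clm: "\<Phi> \<in> cont_linear_maps A B"
    by (rule isometric_isomorphism_cont_linear[OF A \<Phi>])
  have \<Phi>B: "\<Phi> v \<in> B" and iso: "norm (\<Phi> v) = norm v" if "v \<in> A" for v
    using \<Phi> that by (auto simp: isometric_isomorphism_def)
  have \<Psi>A: "\<Psi> w \<in> A" if "w \<in> B" for w
    using \<Psi> that by (auto simp: cont_linear_maps_def)
  have ix: "i x \<in> A" for x using iA by auto
  obtain T where T: "T \<in> cont_linear_maps A W" "\<And>x. T (i x) = \<theta> x"
    "\<And>v. v \<in> A \<Longrightarrow> norm (T v) \<le> lip_const \<theta> * norm v"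
    using AE_universal_extension[OF univ A W \<theta>] by auto
  let ?T = "\<lambda>w\<in>B. T (\<Psi> w)"
  have T': "?T \<in> cont_linear_maps B W"
    by (rule cont_linear_maps_compose[OF \<Psi>(1) T(1) B])
  have T'j: "?T ((\<Phi> \<circ> i) x) = \<theta> x" for x
    using \<Phi>B[OF ix] \<Psi>(2)[OF ix] T(2) by simp
  have uniq: "S = ?T" if S: "S \<in> cont_linear_maps B W \<and> (\<forall>x. S ((\<Phi> \<circ> i) x) = \<theta> x)" for S
  proof (rule extensionalityI[of _ B])
    have "(\<lambda>v\<in>A. S (\<Phi> v)) = T"
      using S ix T(2)
      by (intro AE_universal_unique[OF univ W \<theta> T(1)] cont_linear_maps_compose[OF clm _ A]) simp_all
    from fun_cong[OF this] show "S w = ?T w" if "w \<in> B" for w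
      using \<Psi>(3)[OF that] \<Psi>A[OF that] that by (metis restrict_apply')
  qed (use S in \<open>auto simp: cont_linear_maps_def PiE_def\<close>)
  show "\<exists>!\<theta>'. \<theta>' \<in> cont_linear_maps B W \<and> (\<forall>x. \<theta>' ((\<Phi> \<circ> i) x) = \<theta> x)"
    using T' T'j uniq by blast
  have "norm (?T w) \<le> lip_const \<theta> * norm w" if "w \<in> B" for w
    using T(3)[OF \<Psi>A[OF that]] iso[OF \<Psi>A[OF that]] \<Psi>(3)[OF that] that by simp
  moreover have "0 \<le> lip_const \<theta>"
    using \<theta> lipschitz_on_nonneg[OF lipschitz_on_lip_const] by (auto simp: Lip_over_def)
  ultimately have "onorm_on B ?T \<le> lip_const \<theta>"
    using subspace_0[OF B] by (intro onorm_on_le) auto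
  then show "onorm_on B \<theta>' \<le> lip_const \<theta>"
    if "\<theta>' \<in> cont_linear_maps B W \<and> (\<forall>x. \<theta>' ((\<Phi> \<circ> i) x) = \<theta> x)" for \<theta>'
    using uniq[OF that] by simp
qed

section \<open>Duality by restriction to \<open>X\<close>\<close>

text \<open>\<open>i x - i y\<close> has norm \<open>dist x y\<close>, so the operator norm of
  \<open>T\<close> bounds the Lipschitz constant on \<open>X\<close>; this is one half of the
  isometry in the duality.\<close>

lemma lipschitz_on_compose_isometric:
  assumes ext: "banach_extension \<iota> A i" and T: "T \<in> cont_linear_maps A W"
  shows "(onorm_on A T)-lipschitz_on UNIV (T \<circ> i)"
proof (rule lipschitz_onI)
  have A: "subspace A" and iA: "i x \<in> A" and iso: "dist (i x) (i y) = dist x y" for x y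
    using ext by (auto simp: banach_extension_def banach_space_on_def isometric_map_def)
  have lin: "linear_on_subspace A T" and cont: "continuous_on A T"
    using T by (auto simp: cont_linear_maps_def)
  show "0 \<le> onorm_on A T"
    by (rule onorm_on_nonneg[OF A lin cont])
  show "dist ((T \<circ> i) x) ((T \<circ> i) y) \<le> onorm_on A T * dist x y" for x y
    using norm_le_onorm_on[OF A lin cont subspace_diff[OF A iA iA], of x y] iso[of x y]
    by (simp add: dist_norm linear_on_subspace_diff[OF lin iA iA])
qed

lemma Lip_over_compose:
  assumes ext: "banach_extension \<iota> A i" and T: "T \<in> cont_linear_maps A W"
  shows "T \<circ> i \<in> Lip_over \<iota> W"
proof -
  have A: "subspace A" and iA: "i x \<in> A" and lin: "linear (i \<circ> \<iota>)" for x
    using ext by (auto simp: banach_extension_def banach_space_on_def)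
  have linT: "linear_on_subspace A T" and TW: "T ` A \<subseteq> W"
    using T by (auto simp: cont_linear_maps_def)
  have "linear (T \<circ> i \<circ> \<iota>)"
    using linear_add[OF lin] linear_cmul[OF lin] iA
    by (intro linearI) (auto simp: linear_on_subspace_add[OF linT] linear_on_subspace_scaleR[OF A linT])
  then show ?thesis
    using lipschitz_on_compose_isometric[OF ext T] TW iA by (auto simp: Lip_over_def)
qed

lemma banach_space_on_UNIV: "banach_space_on (UNIV :: 'a::banach set)"
  by (simp add: banach_space_on_def complete_UNIV)

text \<open>Used for the linearity of restriction. The combination is cut off outside
  \<open>V\<close> because functionals on \<open>V\<close> are extensional.\<close>

lemma dual_lin_comb:
  assumes V: "subspace V" and "\<phi> \<in> cont_linear_maps V (UNIV :: real set)"
    and "\<psi> \<in> cont_linear_maps V (UNIV :: real set)"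
  shows "(\<lambda>v\<in>V. a * \<phi> v + b * \<psi> v) \<in> cont_linear_maps V (UNIV :: real set)"
proof -
  have "continuous_on V (\<lambda>v. a * \<phi> v + b * \<psi> v)"
    using assms by (intro continuous_intros) (auto simp: cont_linear_maps_def)
  moreover have "linear_on_subspace V (\<lambda>v\<in>V. a * \<phi> v + b * \<psi> v)"
    using assms subspace_add[OF V] subspace_scale[OF V]
    by (simp add: cont_linear_maps_def linear_on_subspace_def algebra_simps)
  ultimately show ?thesis
    by (auto simp: cont_linear_maps_def cong: continuous_on_cong)
qed

text \<open>The third and fourth conjuncts form the characterisation: comparing \<open>B\<close>
  with \<open>AE_space\<close> takes the universal property of \<open>B\<close> for targets in its
  own type and in that of \<open>AE_space\<close>, and conversely isometric copies are again
  solutions. The last three conjuncts are the duality.\<close>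

theorem theorem2p4:
  fixes \<iota> :: "'e::real_normed_vector \<Rightarrow> 'x::metric_space"
  assumes "metric_space_over \<iota>"
  shows "banach_extension \<iota> (AE_space \<iota>) (AE_emb \<iota>)
    \<and> AE_universal TYPE('f::real_normed_vector) \<iota> (AE_space \<iota>) (AE_emb \<iota>)
    \<and> (\<forall>(B :: 'b::real_normed_vector set) j.
         banach_extension \<iota> B j \<and> AE_universal TYPE('b) \<iota> B j
           \<and> AE_universal TYPE('x ae_type) \<iota> B j \<longrightarrow>
         (\<exists>!\<Phi>. isometric_isomorphism (AE_space \<iota>) B \<Phi> \<and> (\<forall>x. \<Phi> (AE_emb \<iota> x) = j x)))
    \<and> (\<forall>(B :: 'b set) \<Phi>.
         banach_space_on B \<and> isometric_isomorphism (AE_space \<iota>) B \<Phi> \<longrightarrow>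
         banach_extension \<iota> B (\<Phi> \<circ> AE_emb \<iota>)
           \<and> AE_universal TYPE('f) \<iota> B (\<Phi> \<circ> AE_emb \<iota>))
    \<and> bij_betw (\<lambda>\<phi>. \<phi> \<circ> AE_emb \<iota>)
         (cont_linear_maps (AE_space \<iota>) (UNIV :: real set)) (Lip_over \<iota> (UNIV :: real set))
    \<and> (\<forall>\<phi> \<in> cont_linear_maps (AE_space \<iota>) (UNIV :: real set).
         lip_const (\<phi> \<circ> AE_emb \<iota>) = onorm_on (AE_space \<iota>) \<phi>)
    \<and> (\<forall>\<phi> \<in> cont_linear_maps (AE_space \<iota>) (UNIV :: real set).
       \<forall>\<psi> \<in> cont_linear_maps (AE_space \<iota>) (UNIV :: real set). \<forall>a b.
         (\<lambda>v\<in>AE_space \<iota>. a * \<phi> v + b * \<psi> v) \<in> cont_linear_maps (AE_space \<iota>) (UNIV :: real set)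
         \<and> (\<lambda>v\<in>AE_space \<iota>. a * \<phi> v + b * \<psi> v) \<circ> AE_emb \<iota>
            = (\<lambda>x. a * (\<phi> \<circ> AE_emb \<iota>) x + b * (\<psi> \<circ> AE_emb \<iota>) x))"
proof -
  let ?A = "AE_space \<iota>" and ?i = "AE_emb \<iota>"
  have ext: "banach_extension \<iota> ?A ?i"
    by (rule AE_space_banach_extension[OF assms])
  have A: "subspace ?A" by (rule subspace_AE_space)
  have univ_real: "AE_universal TYPE(real) \<iota> ?A ?i" by (rule AE_space_universal)
  \<comment> \<open>Injectivity is the density of the span of \<open>X\<close>; surjectivity is the
    existence of extensions with values in the reals.\<close>
  have bij: "bij_betw (\<lambda>\<phi>. \<phi> \<circ> ?i) (cont_linear_maps ?A (UNIV :: real set)) (Lip_over \<iota> UNIV)"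
    unfolding bij_betw_def
  proof (intro conjI set_eqI iffI inj_onI)
    fix S T :: "'x ae_type \<Rightarrow> real"
    assume ST: "S \<in> cont_linear_maps ?A UNIV" "T \<in> cont_linear_maps ?A UNIV"
      and "S \<circ> ?i = T \<circ> ?i"
    then have "S (?i x) = T (?i x)" for x
      by (metis comp_apply)
    with ST show "S = T"
      by (rule AE_space_eqI)
  next
    fix \<theta> :: "'x \<Rightarrow> real" assume \<theta>: "\<theta> \<in> Lip_over \<iota> UNIV"
    obtain T where "T \<in> cont_linear_maps ?A UNIV" "\<And>x. T (?i x) = \<theta> x"
      using AE_universal_extension[OF univ_real A banach_space_on_UNIV \<theta>] by auto
    then show "\<theta> \<in> (\<lambda>\<phi>. \<phi> \<circ> ?i) ` cont_linear_maps ?A UNIV"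
      by (intro image_eqI[of _ _ T]) auto
  qed (use Lip_over_compose[OF ext] in auto)
  have norm_eq: "lip_const (\<phi> \<circ> ?i) = onorm_on ?A \<phi>"
    if \<phi>: "\<phi> \<in> cont_linear_maps ?A (UNIV :: real set)" for \<phi>
  proof (rule antisym)
    show "lip_const (\<phi> \<circ> ?i) \<le> onorm_on ?A \<phi>"
      by (rule lip_const_le[OF lipschitz_on_compose_isometric[OF ext \<phi>]])
    \<comment> \<open>\<open>\<phi>\<close> is the extension of its own restriction, so this is the
      norm clause of the universal property.\<close>
    show "onorm_on ?A \<phi> \<le> lip_const (\<phi> \<circ> ?i)"
      using univ_real banach_space_on_UNIV Lip_over_compose[OF ext \<phi>] \<phi>
      unfolding AE_universal_def by fastforce
  qed
  show ?thesis
  proof (intro conjI allI impI ballI)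
    show "AE_universal TYPE('f) \<iota> ?A ?i" by (rule AE_space_universal)
  next
    fix B :: "'b set" and j
    assume "banach_extension \<iota> B j \<and> AE_universal TYPE('b) \<iota> B j
      \<and> AE_universal TYPE('x ae_type) \<iota> B j"
    then show "\<exists>!\<Phi>. isometric_isomorphism ?A B \<Phi> \<and> (\<forall>x. \<Phi> (?i x) = j x)"
      by (elim conjE) (rule AE_space_unique[OF assms])
  next
    fix B :: "'b set" and \<Phi>
    assume B: "banach_space_on B \<and> isometric_isomorphism ?A B \<Phi>"
    then show "banach_extension \<iota> B (\<Phi> \<circ> ?i)"
      by (elim conjE) (rule banach_extension_isometric_isomorphism[OF ext])
    show "AE_universal TYPE('f) \<iota> B (\<Phi> \<circ> ?i)"
    proof (rule AE_universal_isometric_isomorphism[OF AE_space_universal A])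
      show "range ?i \<subseteq> ?A" using AE_emb_in_AE_space by (rule image_subsetI)
    qed (use B in \<open>simp_all add: banach_space_on_def\<close>)
  next
    fix \<phi> \<psi> :: "'x ae_type \<Rightarrow> real" and a b
    assume "\<phi> \<in> cont_linear_maps ?A UNIV" "\<psi> \<in> cont_linear_maps ?A UNIV"
    then show "(\<lambda>v\<in>?A. a * \<phi> v + b * \<psi> v) \<in> cont_linear_maps ?A UNIV"
      by (rule dual_lin_comb[OF A])
    show "(\<lambda>v\<in>?A. a * \<phi> v + b * \<psi> v) \<circ> ?i = (\<lambda>x. a * (\<phi> \<circ> ?i) x + b * (\<psi> \<circ> ?i) x)"
      by (simp add: fun_eq_iff AE_emb_in_AE_space)
  qed (fact ext bij norm_eq)+
qed

end
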